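(* Let $n\geq 1$ be an integer. Then, as formal power series in $x$ and $q$, $$\frac{\sum_{\sigma \in S_n} q^{\mathrm{omaj}(\sigma)} x^{\mathrm{odes}(\sigma)}}{\prod_{i=1}^{\lfloor n/2\rfloor}(1-xq^i)} =\frac{n!}{2^{\lfloor n/2\rfloor}}\sum_{\{\lambda \in \overline{\mathcal P}:\ \lambda_1\leq \lfloor n/2\rfloor\}} q^{|\lambda|}x^{\ell(\lambda)},$$ and $$\frac{\sum_{\sigma \in S_n} q^{\mathrm{emaj}(\sigma)} x^{\mathrm{edes}(\sigma)}}{\prod_{i=1}^{\lfloor (n-1)/2\rfloor}(1-xq^i)} =\frac{n!}{2^{\lfloor (n-1)/2\rfloor}}\sum_{\{\lambda \in \overline{\mathcal P}:\ \lambda_1\leq \lfloor (n-1)/2\rfloor\}} q^{|\lambda|}x^{\ell(\lambda)}.$$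
   Context: $S_n$ is the group of bijections of $[n]=\{1,\dots,n\}$. For $\sigma\in S_n$: $D(\sigma)=\{i\in[n-1]:\sigma(i)>\sigma(i+1)\}$; $D(\sigma)_o$ and $D(\sigma)_e$ are the sets of odd, respectively even, elements of $D(\sigma)$; $\mathrm{odes}(\sigma)=|D(\sigma)_o|$, $\mathrm{edes}(\sigma)=|D(\sigma)_e|$, $\mathrm{omaj}(\sigma)=\sum_{i\in D(\sigma)_o}\frac{i+1}{2}$, $\mathrm{emaj}(\sigma)=\sum_{i\in D(\sigma)_e}\frac{i}{2}$. An overpartition is an integer partition in which the last occurrence of each number may (or may not) be overlined; e.g. the overpartitions of $2$ with distinct markings counted separately are $(2),(\overline 2),(1,1),(1,\overline 1)$. $\overline{\mathcal P}$ is the set of all overpartitions (of all non-negative integers, including the empty one). For $\lambda\in\overline{\mathcal P}$, $|\lambda|$ is the sum of the parts, $\ell(\lambda)$ the number of parts, and $\lambda_1$ the numerical value of the largest part (overlined or not), with $\lambda_1=0$ for the empty overpartition. Empty products equal $1$. *)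

theory Defs
  imports
    "HOL-Analysis.Infinite_Sum"
    "HOL-Combinatorics.Permutations"
    "HOL-Computational_Algebra.Formal_Power_Series"
begin

definition descents :: "nat \<Rightarrow> (nat \<Rightarrow> nat) \<Rightarrow> nat set" where
  "descents n \<sigma> = {i \<in> {1..n - 1}. \<sigma> i > \<sigma> (i + 1)}"

definition odescents :: "nat \<Rightarrow> (nat \<Rightarrow> nat) \<Rightarrow> nat set" where
  "odescents n \<sigma> = {i \<in> descents n \<sigma>. odd i}"

definition edescents :: "nat \<Rightarrow> (nat \<Rightarrow> nat) \<Rightarrow> nat set" where
  "edescents n \<sigma> = {i \<in> descents n \<sigma>. even i}"

definition odes :: "nat \<Rightarrow> (nat \<Rightarrow> nat) \<Rightarrow> nat" where
  "odes n \<sigma> = card (odescents n \<sigma>)"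

definition edes :: "nat \<Rightarrow> (nat \<Rightarrow> nat) \<Rightarrow> nat" where
  "edes n \<sigma> = card (edescents n \<sigma>)"

definition omaj :: "nat \<Rightarrow> (nat \<Rightarrow> nat) \<Rightarrow> nat" where
  "omaj n \<sigma> = (\<Sum>i\<in>odescents n \<sigma>. (i + 1) div 2)"

definition emaj :: "nat \<Rightarrow> (nat \<Rightarrow> nat) \<Rightarrow> nat" where
  "emaj n \<sigma> = (\<Sum>i\<in>edescents n \<sigma>. i div 2)"

text \<open>
  An overpartition is the weakly decreasing list of its parts, each part being a positive number
  together with a flag telling whether it is overlined. Only the last of several equal parts may
  carry the flag.
\<close>

type_synonym overpartition = "(nat \<times> bool) list"

definition overpartitions :: "overpartition set" where
  "overpartitions = {ps.
     (\<forall>p \<in> set ps. fst p > 0) \<and>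
     sorted_wrt (\<ge>) (map fst ps) \<and>
     (\<forall>i j. i < j \<and> j < length ps \<and> fst (ps ! i) = fst (ps ! j) \<longrightarrow> \<not> snd (ps ! i))}"

definition op_size :: "overpartition \<Rightarrow> nat" where
  "op_size ps = sum_list (map fst ps)"

definition op_largest :: "overpartition \<Rightarrow> nat" where
  "op_largest ps = Max (insert 0 (fst ` set ps))"

text \<open>
  Power series in \<open>x\<close> and \<open>q\<close> over the rationals are series in \<open>x\<close> whose coefficients are series
  in \<open>q\<close>. Infinite sums are taken in the topology of \<^typ>\<open>rat fps fps\<close>, which is the \<open>x\<close>-adic one.
  The library's division is multiplication by the inverse whenever the denominator has constant
  term \<open>1\<close> in \<open>x\<close>, because \<^term>\<open>inverse (1 :: rat fps) = 1\<close>.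
\<close>

abbreviation X :: "rat fps fps" where
  "X \<equiv> fps_X"

abbreviation Q :: "rat fps fps" where
  "Q \<equiv> fps_const fps_X"

abbreviation scalar :: "rat \<Rightarrow> rat fps fps" where
  "scalar c \<equiv> fps_const (fps_const c)"

end

theory Submission
  imports Defs
begin

text \<open>
  Both identities say that a generating function over permutations is a constant times the
  generating function \<open>\<Prod>i=1..m. (1 + X Q\<^sup>i) / (1 - X Q\<^sup>i)\<close> of the overpartitions with parts at
  most \<open>m\<close>.

  The positions of one parity form a set \<open>I\<close> of which no two elements are adjacent. For a uniformly
  random permutation, whether there is a descent at \<open>i \<in> I\<close> depends only on the order of the two
  values at \<open>i\<close> and \<open>i + 1\<close>, and these pairs of positions are disjoint for different \<open>i\<close>. Exchanging the
  two values of one pair reverses its order and leaves the other pairs alone, so the descents at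
  the positions of \<open>I\<close> are independent fair coin flips. Giving a descent at \<open>i\<close> the weight
  \<open>a i\<close>, the permutations of \<open>{1..n}\<close> have total weight
  \<open>n! / 2\<^bsup>card I\<^esup> * (\<Prod>i\<in>I. 1 + a i)\<close>; this is \<open>sum_prod_descent_weights\<close>. With \<open>a i = X Q\<^sup>j\<close> at
  the \<open>j\<close>-th element \<open>i\<close> of \<open>I\<close>, the product of the weights is the monomial of the two statistics.

  The overpartitions are counted by splitting off the largest part
  (\<open>bounded_overpartitions_Suc_Suc\<close>), which determines how the series changes when the bound on
  the parts grows by one (\<open>overpartition_series_Suc\<close>). The infinite sum converges to that series
  because only finitely many overpartitions with bounded parts have a given length
  (\<open>has_sum_overpartition_series\<close>).
\<close>

unbundle fps_syntax

section \<open>Descents at pairwise non-adjacent positions\<close>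

text \<open>
  The induction adds one position \<open>j\<close> to \<open>I\<close>. Composing with the transposition of \<open>j\<close> and \<open>j + 1\<close>
  permutes the summands; averaging over it replaces the factor for \<open>j\<close> by \<open>(1 + a j) / 2\<close>. The power
  of two stays on the left so that no division is needed.
\<close>

lemma sum_prod_descent_weights:
  fixes a :: "nat \<Rightarrow> 'a :: {comm_semiring_1, semiring_char_0}"
  assumes "finite I" "I \<subseteq> {1..n - 1}" "\<And>i. i \<in> I \<Longrightarrow> Suc i \<notin> I"
  shows "2 ^ card I * (\<Sum>\<sigma> | \<sigma> permutes {1..n}. \<Prod>i\<in>I. if \<sigma> i > \<sigma> (Suc i) then a i else 1)
           = fact n * (\<Prod>i\<in>I. 1 + a i)"
  using assms
proof (induction I rule: finite_induct)
  case empty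
  have "card {\<sigma>. \<sigma> permutes {1..n}} = fact n"
    by (rule card_permutations) auto
  then show ?case by simp
next
  case (insert j I)
  define w where "w i \<sigma> = (if \<sigma> i > \<sigma> (Suc i) then a i else 1)" for i and \<sigma> :: "nat \<Rightarrow> nat"
  define F where "F \<sigma> = (\<Prod>i\<in>I. w i \<sigma>)" for \<sigma>
  define t where "t = transpose j (Suc j)"
  define P where "P = {\<sigma>. \<sigma> permutes {1..n}}"
  have t: "t permutes {1..n}"
    unfolding t_def using insert.prems(1) by (intro permutes_swap_id) auto
  have F_swap: "F (\<sigma> \<circ> t) = F \<sigma>" for \<sigma>
  proof -
    have "w i (\<sigma> \<circ> t) = w i \<sigma>" if "i \<in> I" for i
    proof -
      have "i \<noteq> j" "i \<noteq> Suc j" "Suc i \<noteq> j"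
        using that insert.hyps insert.prems(2)[of i] insert.prems(2)[of j] by auto
      then show ?thesis by (simp add: w_def t_def transpose_def)
    qed
    then show ?thesis by (simp add: F_def)
  qed
  have w_swap: "w j \<sigma> + w j (\<sigma> \<circ> t) = 1 + a j" if "\<sigma> \<in> P" for \<sigma>
  proof -
    have "\<sigma> j \<noteq> \<sigma> (Suc j)"
      using permutes_inj[of \<sigma> "{1..n}"] that by (simp add: P_def inj_eq)
    then show ?thesis by (auto simp: w_def t_def add.commute)
  qed
  have IH: "2 ^ card I * sum F P = fact n * (\<Prod>i\<in>I. 1 + a i)"
    using insert by (simp add: F_def w_def P_def)
  have "2 * (\<Sum>\<sigma>\<in>P. w j \<sigma> * F \<sigma>)
          = (\<Sum>\<sigma>\<in>P. w j \<sigma> * F \<sigma>) + (\<Sum>\<sigma>\<in>P. w j (\<sigma> \<circ> t) * F (\<sigma> \<circ> t))"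
    unfolding P_def using sum_permutations_compose_right[OF t, of "\<lambda>\<sigma>. w j \<sigma> * F \<sigma>"]
    by (simp add: mult_2)
  also have "\<dots> = (\<Sum>\<sigma>\<in>P. (w j \<sigma> + w j (\<sigma> \<circ> t)) * F \<sigma>)"
    by (simp add: F_swap sum.distrib distrib_right)
  also have "\<dots> = (1 + a j) * sum F P"
    by (simp add: w_swap sum_distrib_left)
  finally have step: "2 * (\<Sum>\<sigma>\<in>P. w j \<sigma> * F \<sigma>) = (1 + a j) * sum F P" .
  have "2 ^ card (insert j I) * (\<Sum>\<sigma>\<in>P. \<Prod>i\<in>insert j I. w i \<sigma>)
          = 2 ^ card I * (2 * (\<Sum>\<sigma>\<in>P. w j \<sigma> * F \<sigma>))"
    using insert.hyps by (simp add: F_def algebra_simps)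
  also have "\<dots> = (1 + a j) * (2 ^ card I * sum F P)"
    by (simp add: step mult.left_commute)
  also have "\<dots> = fact n * (\<Prod>i\<in>insert j I. 1 + a i)"
    using insert.hyps by (simp add: IH mult.left_commute)
  finally show ?case by (simp add: w_def P_def)
qed

section \<open>Overpartitions with bounded parts\<close>

definition bounded_overpartitions :: "nat \<Rightarrow> nat \<Rightarrow> overpartition set" where
  "bounded_overpartitions m k = {ps \<in> overpartitions. op_largest ps \<le> m \<and> length ps = k}"

lemma op_largest_le_iff: "op_largest ps \<le> m \<longleftrightarrow> (\<forall>p\<in>set ps. fst p \<le> m)"
  by (auto simp: op_largest_def)

text \<open>
  Only the last of several equal parts may be overlined, so an overlined first part has to be
  larger than all later parts, while a plain first part may be repeated.
\<close>

lemma Cons_in_overpartitions_iff: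
  "p # ps \<in> overpartitions \<longleftrightarrow>
     fst p > 0 \<and> ps \<in> overpartitions \<and>
     (\<forall>r\<in>set ps. if snd p then fst r < fst p else fst r \<le> fst p)"
  (is "?L \<longleftrightarrow> ?R")
proof -
  let ?ok = "\<lambda>ps :: overpartition. \<forall>i j. i < j \<and> j < length ps \<and> fst (ps ! i) = fst (ps ! j) \<longrightarrow> \<not> snd (ps ! i)"
  \<comment> \<open>With bounded quantifiers, both ranges can be split into the first index and its successors.\<close>
  have ok_iff: "?ok qs \<longleftrightarrow> (\<forall>j<length qs. \<forall>i<j. fst (qs ! i) = fst (qs ! j) \<longrightarrow> \<not> snd (qs ! i))" for qs
    by blast
  have ok_Cons: "?ok (p # ps) \<longleftrightarrow> ?ok ps \<and> (snd p \<longrightarrow> (\<forall>r\<in>set ps. fst r \<noteq> fst p))"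
    unfolding ok_iff all_set_conv_all_nth by (auto simp: All_less_Suc2)
  have positive_Cons: "(\<forall>q\<in>set (p # ps). fst q > 0) \<longleftrightarrow> fst p > 0 \<and> (\<forall>q\<in>set ps. fst q > 0)"
    by simp
  have sorted_Cons: "sorted_wrt (\<ge>) (map fst (p # ps))
      \<longleftrightarrow> (\<forall>r\<in>set ps. fst r \<le> fst p) \<and> sorted_wrt (\<ge>) (map fst ps)"
    by simp
  have bound: "(\<forall>r\<in>set ps. if snd p then fst r < fst p else fst r \<le> fst p)
      \<longleftrightarrow> (\<forall>r\<in>set ps. fst r \<le> fst p) \<and> (snd p \<longrightarrow> (\<forall>r\<in>set ps. fst r \<noteq> fst p))"
    by (cases "snd p") (simp_all add: less_le ball_conj_distrib)
  show ?thesis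
    unfolding overpartitions_def mem_Collect_eq ok_Cons positive_Cons sorted_Cons bound by blast
qed

lemma bounded_overpartitions_0_right: "bounded_overpartitions m 0 = {[]}"
  by (auto simp: bounded_overpartitions_def overpartitions_def op_largest_le_iff)

lemma bounded_overpartitions_0_Suc: "bounded_overpartitions 0 (Suc k) = {}"
  unfolding bounded_overpartitions_def op_largest_le_iff
  by (auto simp: length_Suc_conv Cons_in_overpartitions_iff)

text \<open>
  Either no part equals \<open>m + 1\<close>, or the first part does: overlined, it is the only such part, and
  plain, it may be followed by any overpartition with parts at most \<open>m + 1\<close>.
\<close>

lemma bounded_overpartitions_Suc_Suc:
  "bounded_overpartitions (Suc m) (Suc k) =
     bounded_overpartitions m (Suc k)
     \<union> Cons (Suc m, True) ` bounded_overpartitions m k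
     \<union> Cons (Suc m, False) ` bounded_overpartitions (Suc m) k" (is "?L = ?A \<union> ?B \<union> ?C")
proof (intro equalityI subsetI)
  fix qs assume "qs \<in> ?L"
  then obtain p ps where qs: "qs = p # ps" "p # ps \<in> overpartitions" "length ps = k"
      "fst p \<le> Suc m"
    by (auto simp: bounded_overpartitions_def op_largest_le_iff length_Suc_conv)
  have le: "\<forall>r\<in>set ps. if snd p then fst r < fst p else fst r \<le> fst p" and ps: "ps \<in> overpartitions"
    using qs by (simp_all add: Cons_in_overpartitions_iff)
  consider "fst p \<le> m" | "p = (Suc m, True)" | "p = (Suc m, False)"
    using qs(4) by (cases p; cases "snd p") (auto simp: le_Suc_eq)
  then show "qs \<in> ?A \<union> ?B \<union> ?C"
  proof cases
    case 1
    have "fst r \<le> m" if "r \<in> set ps" for r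
      using bspec[OF le that] 1 by (simp split: if_splits)
    then have "qs \<in> ?A"
      using qs 1 by (simp add: bounded_overpartitions_def op_largest_le_iff)
    then show ?thesis by simp
  next
    case 2
    then have "qs \<in> ?B"
      using qs(1,3) le ps by (auto simp: bounded_overpartitions_def op_largest_le_iff less_Suc_eq_le)
    then show ?thesis by simp
  next
    case 3
    then have "qs \<in> ?C"
      using qs(1,3) le ps by (auto simp: bounded_overpartitions_def op_largest_le_iff)
    then show ?thesis by simp
  qed
next
  fix qs assume "qs \<in> ?A \<union> ?B \<union> ?C"
  then show "qs \<in> ?L"
    by (auto simp: bounded_overpartitions_def op_largest_le_iff Cons_in_overpartitions_iff
        less_Suc_eq_le) (metis fst_conv le_SucI)
qed

lemma finite_bounded_overpartitions: "finite (bounded_overpartitions m k)"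
proof (induction m arbitrary: k)
  case 0
  show ?case
    by (cases k) (simp_all add: bounded_overpartitions_0_right bounded_overpartitions_0_Suc)
next
  case (Suc m)
  note finite_smaller_bound = Suc.IH
  show ?case
    by (induction k)
      (simp_all add: bounded_overpartitions_0_right bounded_overpartitions_Suc_Suc finite_smaller_bound)
qed

definition overpartition_coeff :: "nat \<Rightarrow> nat \<Rightarrow> rat fps" where
  "overpartition_coeff m k = (\<Sum>ps\<in>bounded_overpartitions m k. fps_X ^ op_size ps)"

definition overpartition_series :: "nat \<Rightarrow> rat fps fps" where
  "overpartition_series m = Abs_fps (overpartition_coeff m)"

lemma overpartition_coeff_Suc_Suc:
  "overpartition_coeff (Suc m) (Suc k) =
     overpartition_coeff m (Suc k)
     + fps_X ^ Suc m * (overpartition_coeff m k + overpartition_coeff (Suc m) k)"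
proof -
  let ?A = "bounded_overpartitions m (Suc k)"
  let ?B = "Cons (Suc m, True) ` bounded_overpartitions m k"
  let ?C = "Cons (Suc m, False) ` bounded_overpartitions (Suc m) k"
  let ?f = "\<lambda>ps. fps_X ^ op_size ps :: rat fps"
  have "?A \<inter> ?B = {}" "(?A \<union> ?B) \<inter> ?C = {}"
    by (auto simp: bounded_overpartitions_def op_largest_le_iff)
  then have "overpartition_coeff (Suc m) (Suc k) = sum ?f ?A + sum ?f ?B + sum ?f ?C"
    by (simp add: overpartition_coeff_def bounded_overpartitions_Suc_Suc sum.union_disjoint
        finite_bounded_overpartitions)
  also have "sum ?f ?B = fps_X ^ Suc m * overpartition_coeff m k"
    by (simp add: sum.reindex overpartition_coeff_def op_size_def power_add sum_distrib_left
        mult.assoc)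
  also have "sum ?f ?C = fps_X ^ Suc m * overpartition_coeff (Suc m) k"
    by (simp add: sum.reindex overpartition_coeff_def op_size_def power_add sum_distrib_left
        mult.assoc)
  finally show ?thesis
    by (simp add: overpartition_coeff_def[of m "Suc k"] algebra_simps)
qed

lemma overpartition_series_0: "overpartition_series 0 = 1"
proof (rule fps_ext)
  fix k
  show "overpartition_series 0 $ k = 1 $ k"
    by (cases k) (simp_all add: overpartition_series_def overpartition_coeff_def
        bounded_overpartitions_0_right bounded_overpartitions_0_Suc op_size_def)
qed

lemma overpartition_series_Suc:
  "(1 - X * Q ^ Suc m) * overpartition_series (Suc m)
     = (1 + X * Q ^ Suc m) * overpartition_series m"
proof -
  let ?G = overpartition_series
  have "?G (Suc m) = ?G m + X * (Q ^ Suc m * (?G m + ?G (Suc m)))"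
  proof (rule fps_ext)
    fix k
    show "?G (Suc m) $ k = (?G m + X * (Q ^ Suc m * (?G m + ?G (Suc m)))) $ k"
    proof (cases k)
      case 0
      then show ?thesis
        by (simp add: overpartition_series_def overpartition_coeff_def bounded_overpartitions_0_right)
    next
      case (Suc l)
      then show ?thesis
        by (simp add: overpartition_series_def overpartition_coeff_Suc_Suc fps_const_power
            del: power_Suc)
    qed
  qed
  then show ?thesis by (simp add: algebra_simps)
qed

lemma overpartition_series_product:
  "(\<Prod>i=1..m. 1 - X * Q ^ i) * overpartition_series m = (\<Prod>i=1..m. 1 + X * Q ^ i)"
proof (induction m)
  case 0
  show ?case by (simp add: overpartition_series_0)
next
  case (Suc m)
  have "(\<Prod>i=1..Suc m. 1 - X * Q ^ i) * overpartition_series (Suc m)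
          = (\<Prod>i=1..m. 1 - X * Q ^ i) * ((1 - X * Q ^ Suc m) * overpartition_series (Suc m))"
    by (simp add: mult.assoc)
  also have "\<dots> = (1 + X * Q ^ Suc m) * ((\<Prod>i=1..m. 1 - X * Q ^ i) * overpartition_series m)"
    by (simp only: overpartition_series_Suc mult.left_commute)
  also have "\<dots> = (\<Prod>i=1..Suc m. 1 + X * Q ^ i)"
    by (simp only: Suc.IH) (simp add: mult.commute)
  finally show ?case .
qed

text \<open>
  In the \<open>X\<close>-adic topology a sum converges as soon as each coefficient of \<open>X\<close> is eventually
  constant, and the coefficient of \<open>X\<^sup>k\<close> is settled once the finite partial sum includes all
  overpartitions of length \<open>k\<close>.
\<close>

lemma has_sum_overpartition_series:
  "((\<lambda>ps. Q ^ op_size ps * X ^ length ps) has_sum overpartition_series m)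
     {ps \<in> overpartitions. op_largest ps \<le> m}"
  unfolding has_sum_def
proof (rule tendsto_fpsI)
  fix k
  let ?A = "{ps \<in> overpartitions. op_largest ps \<le> m}"
  let ?B = "bounded_overpartitions m k"
  have "(\<Sum>ps\<in>F. Q ^ op_size ps * X ^ length ps) $ k = overpartition_series m $ k"
    if "finite F" "?B \<subseteq> F" "F \<subseteq> ?A" for F
  proof -
    have "(\<Sum>ps\<in>F. Q ^ op_size ps * X ^ length ps) $ k
            = (\<Sum>ps\<in>F. if length ps = k then fps_X ^ op_size ps else 0)"
      by (auto simp: fps_sum_nth fps_const_power intro!: sum.cong)
    also have "\<dots> = (\<Sum>ps\<in>{ps \<in> F. length ps = k}. fps_X ^ op_size ps)"
      using that(1) by (simp add: sum.inter_filter)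
    also have "{ps \<in> F. length ps = k} = ?B"
      using that(2,3) by (auto simp: bounded_overpartitions_def)
    finally show ?thesis
      by (simp add: overpartition_series_def overpartition_coeff_def)
  qed
  moreover have "?B \<subseteq> ?A"
    by (auto simp: bounded_overpartitions_def)
  ultimately show "\<forall>\<^sub>F F in finite_subsets_at_top ?A.
      (\<Sum>ps\<in>F. Q ^ op_size ps * X ^ length ps) $ k = overpartition_series m $ k"
    unfolding eventually_finite_subsets_at_top
    using finite_bounded_overpartitions[of m k] by blast
qed

section \<open>The two parities\<close>

text \<open>
  The coefficients in \<open>q\<close> are themselves power series, hence not a field; constant term \<open>1\<close> is what
  makes the denominator invertible.
\<close>

lemma fps_divide_eq_if_mult_eq:
  fixes f g h :: "rat fps fps"
  assumes "g $ 0 = 1" "f = g * h"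
  shows "f / g = h"
proof -
  have "g * inverse g = 1"
    unfolding fps_inverse_def using assms(1) by (intro fps_right_inverse) simp
  moreover have "f / g = f * inverse g"
    using assms(1) by (simp add: fps_divide_unit)
  ultimately show ?thesis
    using assms(2) by (simp add: mult.assoc mult.left_commute)
qed

text \<open>
  The bijection \<open>g\<close> numbers the positions of \<open>I\<close>, so that both parities are instances.
\<close>

lemma descent_series_eq_overpartition_sum:
  fixes g :: "nat \<Rightarrow> nat"
  assumes I: "I \<subseteq> {1..n - 1}" "\<And>i. i \<in> I \<Longrightarrow> Suc i \<notin> I" and g: "bij_betw g I {1..m}"
  shows "(\<Sum>\<sigma> | \<sigma> permutes {1..n}.
             Q ^ (\<Sum>i\<in>{i \<in> I. \<sigma> i > \<sigma> (Suc i)}. g i) * X ^ card {i \<in> I. \<sigma> i > \<sigma> (Suc i)})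
             / (\<Prod>i = 1..m. 1 - X * Q ^ i)
           = scalar (fact n / 2 ^ m)
             * (\<Sum>\<^sub>\<infinity>ps \<in> {ps \<in> overpartitions. op_largest ps \<le> m}. Q ^ op_size ps * X ^ length ps)"
    (is "?S / ?D = ?c * ?O")
proof (rule fps_divide_eq_if_mult_eq)
  show "?D $ 0 = 1"
    by (induction m) simp_all
  have fin: "finite I"
    using I(1) finite_subset by blast
  have card: "card I = m"
    using bij_betw_same_card[OF g] by simp
  have monomial: "Q ^ (\<Sum>i\<in>{i \<in> I. P i}. g i) * X ^ card {i \<in> I. P i}
      = (\<Prod>i\<in>I. if P i then X * Q ^ g i else 1)" for P
    using fin by (simp add: prod.inter_filter[symmetric] prod.distrib power_sum mult.commute)
  have prod: "(\<Prod>i\<in>I. 1 + X * Q ^ g i) = (\<Prod>i=1..m. 1 + X * Q ^ i)"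
    using prod.reindex_bij_betw[OF g, of "\<lambda>i. 1 + X * Q ^ i"] .
  have "2 ^ m * ?S = fact n * (\<Prod>i=1..m. 1 + X * Q ^ i)"
    using sum_prod_descent_weights[OF fin I, of "\<lambda>i. X * Q ^ g i"]
    by (simp only: monomial card prod)
  also have "\<dots> = fact n * (?D * ?O)"
    by (simp only: infsumI[OF has_sum_overpartition_series] overpartition_series_product)
  finally have times_power_of_two: "2 ^ m * ?S = fact n * (?D * ?O)" .
  have inverse: "scalar (1 / 2 ^ m) * 2 ^ m = 1"
  proof -
    have "(2 :: rat fps fps) ^ m = scalar (2 ^ m)"
      by (simp only: fps_numeral_fps_const fps_const_power)
    then show ?thesis by simp
  qed
  have coeff: "scalar (1 / 2 ^ m) * fact n = ?c"
  proof -
    have "(fact n :: rat fps fps) = scalar (fact n)"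
      by (metis fps_of_nat of_nat_fact)
    then show ?thesis by simp
  qed
  have "?S = (scalar (1 / 2 ^ m) * 2 ^ m) * ?S"
    by (simp only: inverse mult_1)
  also have "\<dots> = (scalar (1 / 2 ^ m) * fact n) * (?D * ?O)"
    by (simp only: mult.assoc times_power_of_two)
  also have "\<dots> = ?D * (?c * ?O)"
    by (simp only: coeff mult.left_commute)
  finally show "?S = ?D * (?c * ?O)" .
qed

theorem corollary3p2:
  fixes n :: nat
  assumes "n \<ge> 1"
  shows "(\<Sum>\<sigma> | \<sigma> permutes {1..n}. Q ^ omaj n \<sigma> * X ^ odes n \<sigma>)
             / (\<Prod>i = 1..n div 2. 1 - X * Q ^ i)
           = scalar (fact n / 2 ^ (n div 2))
             * (\<Sum>\<^sub>\<infinity>ps \<in> {ps \<in> overpartitions. op_largest ps \<le> n div 2}. Q ^ op_size ps * X ^ length ps)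
       \<and> (\<Sum>\<sigma> | \<sigma> permutes {1..n}. Q ^ emaj n \<sigma> * X ^ edes n \<sigma>)
             / (\<Prod>i = 1..(n - 1) div 2. 1 - X * Q ^ i)
           = scalar (fact n / 2 ^ ((n - 1) div 2))
             * (\<Sum>\<^sub>\<infinity>ps \<in> {ps \<in> overpartitions. op_largest ps \<le> (n - 1) div 2}. Q ^ op_size ps * X ^ length ps)"
proof -
  have odd: "odescents n \<sigma> = {i \<in> {i \<in> {1..n - 1}. odd i}. \<sigma> i > \<sigma> (Suc i)}" for \<sigma>
    by (auto simp: odescents_def descents_def)
  have even: "edescents n \<sigma> = {i \<in> {i \<in> {1..n - 1}. even i}. \<sigma> i > \<sigma> (Suc i)}" for \<sigma>
    by (auto simp: edescents_def descents_def)
  have odd_bij: "bij_betw (\<lambda>i. (i + 1) div 2) {i \<in> {1..n - 1}. odd i} {1..n div 2}"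
    by (rule bij_betw_byWitness[where f' = "\<lambda>j. 2 * j - 1"])
      (simp add: image_subset_iff Ball_def; presburger)+
  have even_bij: "bij_betw (\<lambda>i. i div 2) {i \<in> {1..n - 1}. even i} {1..(n - 1) div 2}"
    by (rule bij_betw_byWitness[where f' = "\<lambda>j. 2 * j"])
      (simp add: image_subset_iff Ball_def; presburger)+
  have "(\<Sum>\<sigma> | \<sigma> permutes {1..n}. Q ^ omaj n \<sigma> * X ^ odes n \<sigma>) / (\<Prod>i = 1..n div 2. 1 - X * Q ^ i)
      = scalar (fact n / 2 ^ (n div 2))
        * (\<Sum>\<^sub>\<infinity>ps \<in> {ps \<in> overpartitions. op_largest ps \<le> n div 2}. Q ^ op_size ps * X ^ length ps)"
    unfolding omaj_def odes_def odd
    by (rule descent_series_eq_overpartition_sum[OF _ _ odd_bij]) auto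
  moreover have "(\<Sum>\<sigma> | \<sigma> permutes {1..n}. Q ^ emaj n \<sigma> * X ^ edes n \<sigma>)
        / (\<Prod>i = 1..(n - 1) div 2. 1 - X * Q ^ i)
      = scalar (fact n / 2 ^ ((n - 1) div 2))
        * (\<Sum>\<^sub>\<infinity>ps \<in> {ps \<in> overpartitions. op_largest ps \<le> (n - 1) div 2}. Q ^ op_size ps * X ^ length ps)"
    unfolding emaj_def edes_def even
    by (rule descent_series_eq_overpartition_sum[OF _ _ even_bij]) auto
  ultimately show ?thesis by (rule conjI)
qed

end
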